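(* Let $\mathcal G$ be an undirected graph on $N$ nodes with adjacency matrix $\mathbf A$ and node feature matrix $\mathbf X\in\mathbb R^{N\times F}$. Consider the SGC encoder of node $i$ at depth $\ell$, $\phi^{(\ell)}(x_i;\mathbf X,\mathbf A):=(\hat{\mathbf A}^{\ell}\mathbf X)_{i\cdot}$. Then there exist finite constants $C_1,C_2$ depending only on $\mathbf X$ and $\hat{\mathbf A}$ such that for any nonempty $\mathcal S,\mathcal T\subseteq\{1,\dots,N\}$ and any $\ell\in\mathbb N$, $$\mathcal W\big(\phi^{(\ell)}_\#\mu_{\mathcal S},\,\phi^{(\ell)}_\#\mu_{\mathcal T}\big)\;\le\;C_1\,\mathcal W\big(d_\#\mu_{\mathcal S},\,d_\#\mu_{\mathcal T}\big)+C_2\,\rho_\perp(\hat{\mathbf A})^{\ell}.$$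
   Context: $\mathbf A\in\{0,1\}^{N\times N}$ is the symmetric adjacency matrix of the undirected graph; $\tilde{\mathbf A}=\mathbf A+\mathbf I$, $\tilde{\mathbf D}=\mathrm{diag}(\tilde{\mathbf A}\mathbf 1)$, $\hat{\mathbf A}=\tilde{\mathbf D}^{-1/2}\tilde{\mathbf A}\tilde{\mathbf D}^{-1/2}$. $\tilde d_i=(\tilde{\mathbf D})_{ii}$ is the degree of node $i$ after adding self-loops, and the degree statistic is $d(x_i)=\sqrt{\tilde d_i}\in\mathbb R$. $\lambda_1(\hat{\mathbf A})\ge\dots\ge\lambda_N(\hat{\mathbf A})$ are the eigenvalues of $\hat{\mathbf A}$ with multiplicity in descending order (the largest is $\lambda_1=1$), and $\rho_\perp(\hat{\mathbf A})=\max_{k\ge2}|\lambda_k(\hat{\mathbf A})|$. $M_{i\cdot}$ denotes the $i$-th row of a matrix $M$. For nonempty $\mathcal S\subseteq\{1,\dots,N\}$, $\mu_{\mathcal S}$ is the uniform probability measure on the nodes in $\mathcal S$, so $\phi^{(\ell)}_\#\mu_{\mathcal S}=\frac1{|\mathcal S|}\sum_{i\in\mathcal S}\delta_{\phi^{(\ell)}(x_i;\mathbf X,\mathbf A)}$ and $d_\#\mu_{\mathcal S}=\frac1{|\mathcal S|}\sum_{i\in\mathcal S}\delta_{d(x_i)}$. $\mathcal W$ is the $1$-Wasserstein distance with Euclidean cost (on $\mathbb R^F$ on the left, on $\mathbb R$ on the right). *)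

theory Defs
  imports
    "HOL-Probability.Probability"
    "HOL-Computational_Algebra.Computational_Algebra"
begin

text \<open>Nodes are the elements of the finite type \<open>'n\<close>, so \<open>N = CARD('n)\<close>. Loops in the
  graph itself (nonzero diagonal entries) are allowed.\<close>

definition adjacency_matrix :: "real^'n^'n \<Rightarrow> bool" where
  "adjacency_matrix A \<longleftrightarrow> (\<forall>i j. A $ i $ j \<in> {0, 1}) \<and> transpose A = A"

definition diag :: "real^'n \<Rightarrow> real^'n^'n" where
  "diag v = (\<chi> i j. if i = j then v $ i else 0)"

definition loop_adjacency :: "real^'n^'n \<Rightarrow> real^'n^'n" where
  "loop_adjacency A = A + mat 1"

text \<open>Here \<open>1\<close> is the all-ones vector.\<close>

definition loop_degree :: "real^'n^'n \<Rightarrow> real^'n" where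
  "loop_degree A = loop_adjacency A *v 1"

definition norm_adjacency :: "real^'n^'n \<Rightarrow> real^'n^'n" where
  "norm_adjacency A =
     diag (\<chi> i. 1 / sqrt (loop_degree A $ i)) ** loop_adjacency A **
     diag (\<chi> i. 1 / sqrt (loop_degree A $ i))"

definition degree_stat :: "real^'n^'n \<Rightarrow> 'n \<Rightarrow> real" where
  "degree_stat A i = sqrt (loop_degree A $ i)"

text \<open>The power class instance on vectors is componentwise, hence the separate matrix power.\<close>

primrec matrix_power :: "real^'n^'n \<Rightarrow> nat \<Rightarrow> real^'n^'n" where
  "matrix_power M 0 = mat 1"
| "matrix_power M (Suc k) = M ** matrix_power M k"

definition sgc :: "nat \<Rightarrow> real^'f^'n \<Rightarrow> real^'n^'n \<Rightarrow> 'n \<Rightarrow> real^'f" where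
  "sgc l X A i = row i (matrix_power (norm_adjacency A) l ** X)"

definition charpoly :: "real^'n^'n \<Rightarrow> real poly" where
  "charpoly M = det (mat [:0, 1:] - map_matrix (\<lambda>c. [:c:]) M)"

text \<open>The real eigenvalues in descending order, repeated according to algebraic multiplicity.
  For symmetric \<open>M\<close> all eigenvalues are real and the list has length \<open>CARD('n)\<close>.
  The list is indexed from 0, so \<open>\<lambda>\<^sub>k\<close> is at position \<open>k - 1\<close>.\<close>

definition eigenvalue_list :: "real^'n^'n \<Rightarrow> real list" where
  "eigenvalue_list M = rev (sorted_list_of_multiset (proots (charpoly M)))"

definition nth_eigenvalue :: "real^'n^'n \<Rightarrow> nat \<Rightarrow> real" where
  "nth_eigenvalue M k = eigenvalue_list M ! (k - 1)"

text \<open>Inserting 0 only fixes the value for a single node, where there is no \<open>k \<ge> 2\<close>; otherwise it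
  does not affect the maximum of absolute values.\<close>

definition rho_perp :: "real^'n^'n \<Rightarrow> real" where
  "rho_perp M = Max (insert 0 ((\<lambda>k. \<bar>nth_eigenvalue M k\<bar>) ` {2..CARD('n)}))"

definition couplings ::
  "'a::{metric_space, second_countable_topology} measure \<Rightarrow> 'a measure \<Rightarrow> ('a \<times> 'a) measure set" where
  "couplings \<mu> \<nu> =
     {\<pi>. sets \<pi> = sets (borel \<Otimes>\<^sub>M borel) \<and> distr \<pi> borel fst = \<mu> \<and> distr \<pi> borel snd = \<nu>}"

definition wasserstein ::
  "'a::{metric_space, second_countable_topology} measure \<Rightarrow> 'a measure \<Rightarrow> ennreal" where
  "wasserstein \<mu> \<nu> = (INF \<pi>\<in>couplings \<mu> \<nu>. \<integral>\<^sup>+ z. ennreal (dist (fst z) (snd z)) \<partial>\<pi>)"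

text \<open>The pushforward \<open>f\<^sub># \<mu>\<^sub>S\<close> of the uniform probability measure on a nonempty set \<open>S\<close> of nodes.\<close>

definition push_uniform :: "('n::finite \<Rightarrow> 'a::topological_space) \<Rightarrow> 'n set \<Rightarrow> 'a measure" where
  "push_uniform f S = distr (measure_pmf (pmf_of_set S)) borel f"

end

theory Submission
  imports Defs
begin

text \<open>The vector \<open>u\<close> with entries \<open>d(x\<^sub>i)\<close> is an eigenvector of the normalised adjacency
  matrix for the eigenvalue 1, and all eigenvalues have modulus at most 1. On the orthogonal
  complement of \<open>u\<close> the operator norm is attained at an eigenvector; since that eigenvector is
  orthogonal to \<open>u\<close>, its eigenvalue and 1 occupy two different places in the list of eigenvalues,
  so its modulus is at most \<open>\<rho>\<^sub>\<perp>\<close>, also when the eigenvalue 1 is not simple. Decomposing each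
  feature column along \<open>u\<close> therefore gives
  \<open>\<phi>(x\<^sub>i) = d(x\<^sub>i) c + O(\<rho>\<^sub>\<perp>\<^sup>l)\<close> with \<open>c\<close> independent of \<open>i\<close>, and hence a pointwise bound of
  the distances of the encodings by those of the degree statistics. Such a bound passes to
  Wasserstein distances because a coupling of the pushforwards under \<open>d\<close> lifts to a coupling of the
  uniform measures on the nodes.\<close>

no_notation fps_nth (infixl \<open>$\<close> 75)

subsection \<open>Wasserstein distance of pushforwards\<close>

text \<open>This supplies competitors for the infimum in \<open>wasserstein\<close>: joint laws of
  indices yield upper bounds, and the product law shows that couplings exist.\<close>

lemma map_pair_distr_in_couplings:
  fixes g :: "'i::finite \<Rightarrow> 'a::{metric_space, second_countable_topology}"
  shows "distr (measure_pmf r) (borel \<Otimes>\<^sub>M borel) (map_prod g g)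
    \<in> couplings (distr (measure_pmf (map_pmf fst r)) borel g) (distr (measure_pmf (map_pmf snd r)) borel g)"
proof -
  have "map_prod g g \<in> measure_pmf r \<rightarrow>\<^sub>M borel \<Otimes>\<^sub>M borel"
    by (simp add: space_pair_measure)
  then show ?thesis
    by (simp add: couplings_def distr_distr map_pmf_rep_eq comp_def)
qed

text \<open>Law of total probability over the fibres of \<open>k\<close>; it recovers a marginal
  from the law of its fibre representatives.\<close>

lemma bind_cond_pmf_fibre:
  "bind_pmf (map_pmf k p) (\<lambda>x. cond_pmf p {y. x = k y}) = p"
  by (rule bind_cond_pmf_cancel) (auto simp: vimage_def eq_commute)

text \<open>Conditionally on the two values of \<open>f\<close> prescribed by \<open>\<pi>\<close>, the two indices are
  drawn independently from the respective fibres of \<open>f\<close>.\<close>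

lemma coupling_lift:
  fixes f :: "'i::finite \<Rightarrow> 'a::{metric_space, second_countable_topology}"
  assumes pi: "\<pi> \<in> couplings (distr (measure_pmf p) borel f) (distr (measure_pmf q) borel f)"
  obtains r :: "('i \<times> 'i) pmf" where "map_pmf fst r = p" "map_pmf snd r = q"
    "(\<integral>\<^sup>+ z. ennreal (dist (f (fst z)) (f (snd z))) \<partial>measure_pmf r)
      = (\<integral>\<^sup>+ z. ennreal (dist (fst z) (snd z)) \<partial>\<pi>)"
proof -
  \<comment> \<open>\<open>s\<close> picks one index in each fibre of \<open>f\<close>; the constant
    default off the finite range keeps it Borel measurable. \<open>k\<close> sends an index to the
    representative of its fibre.\<close>
  define s :: "'a \<Rightarrow> 'i" where "s x = (if x \<in> range f then inv f x else undefined)" for x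
  define k where "k = s \<circ> f"
  have fs: "f (s x) = x" if "x \<in> range f" for x
    using that by (simp add: s_def f_inv_into_f)
  have fk: "f (k i) = f i" for i by (simp add: k_def fs)
  have s_borel [measurable]: "s \<in> borel \<rightarrow>\<^sub>M count_space UNIV"
  proof (subst measurable_count_space_eq2, safe)
    fix a
    have "s -` {a} = {x \<in> range f. inv f x = a} \<union> (if a = undefined then - range f else {})"
      by (auto simp: s_def split: if_splits)
    moreover have "{x \<in> range f. inv f x = a} \<in> sets borel" "range f \<in> sets borel"
      by (auto intro!: borel_closed finite_imp_closed)
    ultimately show "s -` {a} \<inter> space borel \<in> sets borel" by auto
  qed auto
  have [measurable_cong]: "sets \<pi> = sets (borel \<Otimes>\<^sub>M borel)"
    and fst_pi: "distr \<pi> borel fst = distr (measure_pmf p) borel f"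
    and snd_pi: "distr \<pi> borel snd = distr (measure_pmf q) borel f"
    using pi by (auto simp: couplings_def)
  have "prob_space (distr \<pi> borel fst)"
    unfolding fst_pi by (rule measure_pmf.prob_space_distr) simp
  then interpret pi: prob_space \<pi>
    by (rule prob_space_distrD[rotated]) measurable
  have "(\<lambda>z. (s (fst z), s (snd z))) \<in> \<pi> \<rightarrow>\<^sub>M count_space UNIV \<Otimes>\<^sub>M count_space UNIV"
    by measurable
  then have h [measurable]: "map_prod s s \<in> \<pi> \<rightarrow>\<^sub>M count_space UNIV"
    by (simp add: pair_measure_countable map_prod_def split_beta')
  \<comment> \<open>The joint law of the representatives lives on a finite type, so it is purely
    atomic and comes from a pmf.\<close>
  define Q where "Q = distr \<pi> (count_space UNIV) (map_prod s s)"
  interpret Q: prob_space Q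
    unfolding Q_def by (rule pi.prob_space_distr) measurable
  define r0 where "r0 = Abs_pmf Q"
  have "AE x in Q. measure Q {x} \<noteq> 0"
    by (subst Q.AE_support_countable) (auto simp: Q_def intro!: exI[of _ UNIV])
  then have r0: "measure_pmf r0 = Q"
    unfolding r0_def by (intro Abs_pmf_inverse) (simp add: Q.prob_space_axioms, simp add: Q_def)
  have fst_r0: "map_pmf fst r0 = map_pmf k p"
  proof -
    have "measure_pmf (map_pmf fst r0) = distr \<pi> (count_space UNIV) (s \<circ> fst)"
      by (simp add: map_pmf_rep_eq r0 Q_def distr_distr comp_def)
    also have "\<dots> = distr (distr \<pi> borel fst) (count_space UNIV) s"
      by (simp add: distr_distr)
    also have "\<dots> = measure_pmf (map_pmf k p)"
      by (simp add: fst_pi distr_distr map_pmf_rep_eq k_def)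
    finally show ?thesis by (simp add: measure_pmf_inject)
  qed
  have snd_r0: "map_pmf snd r0 = map_pmf k q"
  proof -
    have "measure_pmf (map_pmf snd r0) = distr \<pi> (count_space UNIV) (s \<circ> snd)"
      by (simp add: map_pmf_rep_eq r0 Q_def distr_distr comp_def)
    also have "\<dots> = distr (distr \<pi> borel snd) (count_space UNIV) s"
      by (simp add: distr_distr)
    also have "\<dots> = measure_pmf (map_pmf k q)"
      by (simp add: snd_pi distr_distr map_pmf_rep_eq k_def)
    finally show ?thesis by (simp add: measure_pmf_inject)
  qed
  \<comment> \<open>Each index is resampled within the fibre marked by its representative, which
    turns the marginals \<open>map_pmf k p\<close> and \<open>map_pmf k q\<close> back into
    \<open>p\<close> and \<open>q\<close>.\<close>
  define Kp Kq where "Kp = (\<lambda>x. cond_pmf p {i. x = k i})" and "Kq = (\<lambda>x. cond_pmf q {i. x = k i})"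
  define r where "r = bind_pmf r0 (\<lambda>z. pair_pmf (Kp (fst z)) (Kq (snd z)))"
  have "map_pmf fst r = bind_pmf (map_pmf fst r0) Kp"
    by (simp add: r_def map_bind_pmf map_fst_pair_pmf bind_map_pmf)
  then have 1: "map_pmf fst r = p"
    by (simp add: fst_r0 Kp_def bind_cond_pmf_fibre)
  have "map_pmf snd r = bind_pmf (map_pmf snd r0) Kq"
    by (simp add: r_def map_bind_pmf map_snd_pair_pmf bind_map_pmf)
  then have 2: "map_pmf snd r = q"
    by (simp add: snd_r0 Kq_def bind_cond_pmf_fibre)
  have supp: "f i = f x" "f j = f y"
    if xy: "(x, y) \<in> set_pmf r0" and ij: "i \<in> set_pmf (Kp x)" "j \<in> set_pmf (Kq y)" for x y i j
  proof -
    have "x \<in> set_pmf (map_pmf fst r0)" "y \<in> set_pmf (map_pmf snd r0)"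
      using xy by force+
    then have "set_pmf p \<inter> {i. x = k i} \<noteq> {}" "set_pmf q \<inter> {i. y = k i} \<noteq> {}"
      unfolding fst_r0 snd_r0 by auto
    then show "f i = f x" "f j = f y"
      using ij by (auto simp: Kp_def Kq_def fk)
  qed
  have "(\<integral>\<^sup>+ z. ennreal (dist (f (fst z)) (f (snd z))) \<partial>measure_pmf r)
      = (\<integral>\<^sup>+ z. (\<integral>\<^sup>+ i. \<integral>\<^sup>+ j. ennreal (dist (f i) (f j)) \<partial>Kq (snd z) \<partial>Kp (fst z)) \<partial>r0)"
    by (simp add: r_def nn_integral_pair_pmf')
  \<comment> \<open>Resampling leaves the cost unchanged, since the cost sees the indices only
    through \<open>f\<close>.\<close>
  also have "\<dots> = (\<integral>\<^sup>+ z. (\<integral>\<^sup>+ i. \<integral>\<^sup>+ j. ennreal (dist (f (fst z)) (f (snd z))) \<partial>Kq (snd z) \<partial>Kp (fst z)) \<partial>r0)"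
    using supp by (intro nn_integral_cong_AE AE_pmfI) (metis prod.collapse)
  also have "\<dots> = (\<integral>\<^sup>+ z. ennreal (dist (f (fst z)) (f (snd z))) \<partial>Q)"
    by (simp add: r0)
  also have "\<dots> = (\<integral>\<^sup>+ z. ennreal (dist (f (s (fst z))) (f (s (snd z)))) \<partial>\<pi>)"
    unfolding Q_def by (subst nn_integral_distr) auto
  also have "\<dots> = (\<integral>\<^sup>+ z. ennreal (dist (fst z) (snd z)) \<partial>\<pi>)"
  proof (rule nn_integral_cong_AE)
    \<comment> \<open>Both marginals of \<open>\<pi>\<close> are concentrated on the finite set
      \<open>range f\<close>, where \<open>s\<close> is a right inverse of \<open>f\<close>.\<close>
    have rng: "range f \<in> sets borel" by (auto intro!: borel_closed finite_imp_closed)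
    have "AE x in distr \<pi> borel fst. x \<in> range f" "AE x in distr \<pi> borel snd. x \<in> range f"
      unfolding fst_pi snd_pi using rng by (simp_all add: AE_distr_iff)
    then have "AE z in \<pi>. fst z \<in> range f" "AE z in \<pi>. snd z \<in> range f"
      using rng by (simp_all add: AE_distr_iff)
    then show "AE z in \<pi>. ennreal (dist (f (s (fst z))) (f (s (snd z)))) = ennreal (dist (fst z) (snd z))"
      by eventually_elim (simp add: fs)
  qed
  finally show ?thesis using that 1 2 by blast
qed

text \<open>A pointwise bound integrates against any joint law of indices, and every coupling on the
  \<open>f\<close> side lifts to such a law with the same cost.\<close>

lemma wasserstein_distr_le:
  fixes f :: "'i::finite \<Rightarrow> 'a::{metric_space, second_countable_topology}"
    and g :: "'i \<Rightarrow> 'b::{metric_space, second_countable_topology}"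
  assumes "C \<ge> 0" "e \<ge> 0" and le: "\<And>i j. dist (g i) (g j) \<le> C * dist (f i) (f j) + e"
  shows "wasserstein (distr (measure_pmf p) borel g) (distr (measure_pmf q) borel g)
    \<le> ennreal C * wasserstein (distr (measure_pmf p) borel f) (distr (measure_pmf q) borel f) + ennreal e"
    (is "?W \<le> _ * wasserstein ?P ?Q + _")
proof -
  define cost :: "('a \<times> 'a) measure \<Rightarrow> ennreal"
    where "cost \<pi> = (\<integral>\<^sup>+ z. ennreal (dist (fst z) (snd z)) \<partial>\<pi>)" for \<pi>
  have *: "?W \<le> ennreal C * cost \<pi> + ennreal e" if pi: "\<pi> \<in> couplings ?P ?Q" for \<pi>
  proof -
    obtain r where r: "map_pmf fst r = p" "map_pmf snd r = q"
      and cost: "(\<integral>\<^sup>+ z. ennreal (dist (f (fst z)) (f (snd z))) \<partial>measure_pmf r) = cost \<pi>"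
      using pi unfolding cost_def by (rule coupling_lift)
    have "?W \<le> (\<integral>\<^sup>+ z. ennreal (dist (fst z) (snd z))
        \<partial>distr (measure_pmf r) (borel \<Otimes>\<^sub>M borel) (map_prod g g))"
      unfolding wasserstein_def using map_pair_distr_in_couplings[of r g] r by (auto intro: INF_lower)
    also have "\<dots> = (\<integral>\<^sup>+ z. ennreal (dist (g (fst z)) (g (snd z))) \<partial>measure_pmf r)"
      by (subst nn_integral_distr) (auto simp: space_pair_measure)
    also have "\<dots> \<le> (\<integral>\<^sup>+ z. ennreal C * ennreal (dist (f (fst z)) (f (snd z))) + ennreal e \<partial>measure_pmf r)"
      using assms by (intro nn_integral_mono) (simp add: ennreal_leI flip: ennreal_mult ennreal_plus)
    also have "\<dots> = ennreal C * cost \<pi> + ennreal e"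
      by (simp add: nn_integral_add nn_integral_cmult cost)
    finally show ?thesis .
  qed
  show ?thesis
  proof (cases "C = 0")
    \<comment> \<open>There is nothing to divide by here, but a single coupling suffices, and
      independent indices provide one.\<close>
    case True
    then show ?thesis
      using *[OF map_pair_distr_in_couplings[of "pair_pmf p q" f, unfolded map_fst_pair_pmf map_snd_pair_pmf]]
      by simp
  next
    case False
    with \<open>C \<ge> 0\<close> have C: "0 < ennreal C" "ennreal C < \<top>" by auto
    \<comment> \<open>Solved for the cost, the estimate is a lower bound over all couplings and so
      passes to their infimum.\<close>
    have "(?W - ennreal e) / ennreal C \<le> cost \<pi>" if "\<pi> \<in> couplings ?P ?Q" for \<pi>
      using *[OF that] C by (intro divide_le_posI_ennreal) (auto simp: ennreal_minus_le_iff add.commute)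
    then have "(?W - ennreal e) / ennreal C \<le> wasserstein ?P ?Q"
      unfolding wasserstein_def cost_def by (rule INF_greatest)
    then have "ennreal C * ((?W - ennreal e) / ennreal C) \<le> ennreal C * wasserstein ?P ?Q"
      by (rule mult_left_mono) simp
    also have "ennreal C * ((?W - ennreal e) / ennreal C) = ?W - ennreal e"
      using C by (simp add: ennreal_times_divide mult.commute[of "ennreal C"] ennreal_mult_divide_eq)
    finally show ?thesis
      by (simp add: ennreal_minus_le_iff add.commute)
  qed
qed

subsection \<open>Symmetric matrices\<close>

lemma symmetric_matrix_inner:
  fixes M :: "real^'n^'n"
  assumes "transpose M = M"
  shows "(M *v x) \<bullet> y = x \<bullet> (M *v y)"
  by (metis assms dot_lmul_matrix vector_transpose_matrix)

text \<open>The norm of \<open>M *v x\<close> has a maximiser on the compact unit sphere of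
  \<open>V\<close>. The maximiser need not be an eigenvector itself, but one is built from it and
  its image.\<close>

lemma symmetric_matrix_norm_attained:
  fixes M :: "real^'n^'n"
  assumes sym: "transpose M = M" and V: "subspace V"
    and inv: "\<And>x. x \<in> V \<Longrightarrow> M *v x \<in> V" and nontriv: "\<not> V \<subseteq> {0}"
  obtains v \<mu> where "v \<in> V" "v \<noteq> 0" "M *v v = \<mu> *\<^sub>R v"
    "\<And>x. x \<in> V \<Longrightarrow> norm (M *v x) \<le> \<bar>\<mu>\<bar> * norm x"
proof -
  let ?K = "V \<inter> sphere 0 1"
  have unit: "inverse (norm x) *\<^sub>R x \<in> ?K" if "x \<in> V" "x \<noteq> 0" for x
    using that V by (simp add: subspace_scale)
  have "compact ?K"
    using V by (simp add: closed_subspace closed_Int_compact)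
  moreover have "?K \<noteq> {}"
    using nontriv unit by blast
  moreover have "continuous_on ?K (\<lambda>x. norm (M *v x))"
    by (intro continuous_intros)
  ultimately obtain v where v: "v \<in> ?K" and max: "\<And>x. x \<in> ?K \<Longrightarrow> norm (M *v x) \<le> norm (M *v v)"
    using continuous_attains_sup by metis
  define m where "m = norm (M *v v)"
  have bound: "norm (M *v x) \<le> m * norm x" if "x \<in> V" for x
  proof (cases "x = 0")
    case False
    have "norm (M *v (inverse (norm x) *\<^sub>R x)) \<le> m"
      unfolding m_def by (intro max unit that False)
    with False show ?thesis
      by (simp add: matrix_vector_mult_scaleR field_simps)
  qed simp
  define w where "w = M *v v"
  have wV: "w \<in> V" using v inv by (simp add: w_def)
  \<comment> \<open>Equality in the bound at \<open>v\<close> makes \<open>v\<close> an eigenvector of the square of \<open>M\<close>.\<close>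
  have "M *v w = m\<^sup>2 *\<^sub>R v"
  proof -
    have vv: "v \<bullet> v = 1" using v by (simp add: dot_square_norm)
    have ww: "w \<bullet> w = m\<^sup>2" by (simp add: w_def m_def dot_square_norm)
    have "(norm (M *v w))\<^sup>2 \<le> (m * norm w)\<^sup>2"
      by (intro power_mono bound wV) simp
    then have Mw: "(M *v w) \<bullet> (M *v w) \<le> m\<^sup>2 * m\<^sup>2"
      by (simp add: dot_square_norm power_mult_distrib ww flip: dot_square_norm)
    have "(M *v w) \<bullet> v = m\<^sup>2"
      using ww by (simp add: symmetric_matrix_inner[OF sym] w_def)
    \<comment> \<open>Expanding the square gives a term of at most \<open>m ^ 4\<close>, then
      \<open>- 2 * m ^ 4\<close>, then \<open>m ^ 4\<close>.\<close>
    then have "(norm (M *v w - m\<^sup>2 *\<^sub>R v))\<^sup>2 \<le> 0"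
      using Mw vv by (simp add: power2_norm_eq_inner inner_diff inner_commute)
    then show ?thesis by simp
  qed
  \<comment> \<open>This factors the square of \<open>M\<close> minus the square of
    \<open>m\<close>: either \<open>w + m *\<^sub>R v\<close> is an eigenvector for
    \<open>m\<close>, or it vanishes and \<open>v\<close> is one for \<open>- m\<close>.\<close>
  then have eig: "M *v (w + m *\<^sub>R v) = m *\<^sub>R (w + m *\<^sub>R v)"
    by (simp add: matrix_vector_right_distrib matrix_vector_mult_scaleR w_def[symmetric]
        scaleR_add_right power2_eq_square add.commute)
  have m0: "m \<ge> 0" by (simp add: m_def)
  show ?thesis
  proof (cases "w + m *\<^sub>R v = 0")
    case True
    then have "M *v v = (- m) *\<^sub>R v" by (simp add: w_def add_eq_0_iff)
    with v bound m0 show ?thesis by (intro that[of v "- m"]) auto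
  next
    case False
    have "w + m *\<^sub>R v \<in> V" using v wV V by (simp add: subspace_add subspace_scale)
    with False eig bound m0 show ?thesis by (intro that[of "w + m *\<^sub>R v" m]) auto
  qed
qed

section \<open>Characteristic polynomials and multiplicities of roots\<close>

lemma poly_det:
  fixes P :: "real poly^'n^'n"
  shows "poly (det P) x = det (map_matrix (\<lambda>p. poly p x) P)"
  by (simp add: det_def poly_sum poly_prod of_int_poly)

lemma poly_charpoly:
  fixes M :: "real^'n^'n"
  shows "poly (charpoly M) x = det (mat x - M)"
proof -
  have "map_matrix (\<lambda>p. poly p x) (mat [:0, 1:] - map_matrix (\<lambda>c. [:c:]) M) = mat x - M"
    by (simp add: vec_eq_iff mat_def)
  then show ?thesis by (simp add: charpoly_def poly_det)
qed

lemma poly_charpoly_eq_0_iff: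
  fixes M :: "real^'n^'n"
  shows "poly (charpoly M) x = 0 \<longleftrightarrow> (\<exists>v. v \<noteq> 0 \<and> M *v v = x *\<^sub>R v)"
proof -
  have "mat x *v v = x *\<^sub>R v" for v :: "real^'n"
    by (simp add: vec_eq_iff matrix_vector_mult_def mat_def if_distrib if_distribR cong: if_cong)
  moreover have "det (mat x - M) \<noteq> 0 \<longleftrightarrow> (\<forall>v. (mat x - M) *v v = 0 \<longrightarrow> v = 0)"
    by (metis invertible_det_nz invertible_left_inverse matrix_left_invertible_ker)
  ultimately show ?thesis
    by (auto simp: poly_charpoly matrix_vector_mult_diff_rdistrib)
qed

text \<open>A number above the operator norm is not an eigenvalue, hence not a root.\<close>

lemma charpoly_nonzero:
  fixes M :: "real^'n^'n"
  shows "charpoly M \<noteq> 0"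
proof
  assume "charpoly M = 0"
  then obtain v where v: "v \<noteq> 0" "M *v v = (onorm ((*v) M) + 1) *\<^sub>R v"
    using poly_charpoly_eq_0_iff[of M] by (metis poly_0)
  have "norm (M *v v) \<le> onorm ((*v) M) * norm v"
    by (rule onorm) simp
  moreover have "0 \<le> onorm ((*v) M)"
    by (rule onorm_pos_le) simp
  ultimately show False using v by (simp add: distrib_right)
qed

text \<open>Each product in the Leibniz formula has \<open>CARD('n)\<close> factors of degree at
  most 1. Through the number of roots, this bounds the length of
  \<open>eigenvalue_list\<close>.\<close>

lemma degree_charpoly_le:
  fixes M :: "real^'n^'n"
  shows "degree (charpoly M) \<le> CARD('n)"
proof -
  let ?P = "mat [:0, 1:] - map_matrix (\<lambda>c. [:c:]) M"
  have entry: "degree (?P $ i $ j) \<le> 1" for i j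
    by (auto simp: mat_def intro!: degree_diff_le)
  have "degree (of_int (sign p) * (\<Prod>i\<in>UNIV. ?P $ i $ p i)) \<le> CARD('n)" for p
  proof -
    have "degree (\<Prod>i\<in>UNIV. ?P $ i $ p i) \<le> (\<Sum>i\<in>(UNIV :: 'n set). degree (?P $ i $ p i))"
      using degree_prod_sum_le[of "UNIV :: 'n set" "\<lambda>i. ?P $ i $ p i"] by (simp add: o_def)
    also have "\<dots> \<le> (\<Sum>i\<in>(UNIV :: 'n set). 1)"
      by (intro sum_mono entry)
    finally show ?thesis
      using degree_mult_le[of "of_int (sign p)" "\<Prod>i\<in>UNIV. ?P $ i $ p i"] by simp
  qed
  then show ?thesis
    unfolding charpoly_def det_def by (intro degree_sum_le) auto
qed

lemma map_matrix_const_mult: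
  fixes M :: "real^'n^'m" and N :: "real^'k^'n"
  shows "map_matrix (\<lambda>c. [:c:]) (M ** N) = map_matrix (\<lambda>c. [:c:]) M ** map_matrix (\<lambda>c. [:c:]) N"
  by (simp add: vec_eq_iff matrix_matrix_mult_def mult.commute flip: sum_to_poly)

lemma matrix_diff_ldistrib:
  fixes A :: "'a::ring_1^'n^'m"
  shows "A ** (B - C) = A ** B - A ** C"
  by (simp add: vec_eq_iff matrix_matrix_mult_def right_diff_distrib sum_subtractf)

lemma matrix_diff_rdistrib:
  fixes A :: "'a::ring_1^'n^'m"
  shows "(A - B) ** C = A ** C - B ** C"
  by (simp add: vec_eq_iff matrix_matrix_mult_def left_diff_distrib sum_subtractf)

text \<open>Scalar matrices commute with everything, so the conjugation passes to the whole
  characteristic matrix, and the two outer determinants multiply to 1.\<close>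

lemma charpoly_similar:
  fixes M P Q :: "real^'n^'n"
  assumes "Q ** P = mat 1"
  shows "charpoly (Q ** M ** P) = charpoly M"
proof -
  let ?c = "map_matrix (\<lambda>c. [:c:])" and ?X = "mat [:0, 1:] :: real poly^'n^'n"
  have one: "?c Q ** ?c P = mat 1"
    by (simp add: assms flip: map_matrix_const_mult) (simp add: vec_eq_iff mat_def)
  have "?c Q ** ?X = ?X ** ?c Q"
    by (simp add: vec_eq_iff matrix_matrix_mult_def mat_def if_distrib if_distribR cong: if_cong)
  then have "?c Q ** ?X ** ?c P = ?X"
    by (simp add: one flip: matrix_mul_assoc)
  then have "?X - ?c (Q ** M ** P) = ?c Q ** (?X - ?c M) ** ?c P"
    by (simp add: map_matrix_const_mult matrix_diff_ldistrib matrix_diff_rdistrib)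
  then have "charpoly (Q ** M ** P) = det (?c Q) * charpoly M * det (?c P)"
    by (simp add: charpoly_def det_mul)
  also have "\<dots> = det (?c Q ** ?c P) * charpoly M"
    by (simp add: det_mul)
  finally show ?thesis by (simp add: one)
qed

text \<open>Each of the two columns contributes one linear factor to the determinant; transposing
  allows these factors to be pulled out of rows.\<close>

lemma charpoly_two_scaled_columns:
  fixes M :: "real^'n^'n"
  assumes "a \<noteq> b" "column a M = \<mu> *\<^sub>R axis a 1" "column b M = \<mu> *\<^sub>R axis b 1"
  shows "[:- \<mu>, 1:] ^ 2 dvd charpoly M"
proof -
  let ?P = "transpose (mat [:0, 1:] - map_matrix (\<lambda>c. [:c:]) M)"
  define c where "c i = (if i \<in> {a, b} then [:- \<mu>, 1:] else 1)" for i
  define R where "R i = (if i \<in> {a, b} then axis i 1 else ?P $ i)" for i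
  have "M $ j $ a = (if j = a then \<mu> else 0)" "M $ j $ b = (if j = b then \<mu> else 0)" for j
    using assms(2,3) by (simp_all add: vec_eq_iff column_def axis_def)
  then have "?P = (\<chi> i. c i *s R i)"
    by (auto simp: vec_eq_iff transpose_def mat_def c_def R_def axis_def)
  then have "charpoly M = det (\<chi> i. c i *s R i)"
    unfolding charpoly_def by (metis det_transpose)
  also have "\<dots> = prod c UNIV * det (\<chi> i. R i)"
    by (rule det_rows_mul)
  also have "prod c UNIV = prod c {a, b}"
    by (rule prod.mono_neutral_right) (auto simp: c_def)
  also have "\<dots> = [:- \<mu>, 1:] ^ 2"
    using \<open>a \<noteq> b\<close> by (simp add: c_def power2_eq_square)
  finally show ?thesis by simp
qed

text \<open>Geometric multiplicity two forces algebraic multiplicity two: in a basis extending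
  \<open>u\<close> and \<open>v\<close>, the matrix has two columns that are \<open>\<mu>\<close>
  times unit vectors.\<close>

lemma charpoly_double_root:
  fixes M :: "real^'n^'n"
  assumes "independent {u, v}" "u \<noteq> v" "M *v u = \<mu> *\<^sub>R u" "M *v v = \<mu> *\<^sub>R v"
  shows "[:- \<mu>, 1:] ^ 2 dvd charpoly M"
proof -
  obtain B where B: "{u, v} \<subseteq> B" "independent B" "span B = UNIV"
    using maximal_independent_subset_extend[of "{u, v}" UNIV] assms(1) by (metis UNIV_I subset_UNIV subset_antisym)
  have finB: "finite B" using B by (simp add: independent_imp_finite)
  have "card B = CARD('n)"
    using B(2,3) by (metis basis_card_eq_dim subset_UNIV dim_UNIV DIM_cart DIM_real mult.right_neutral)
  then obtain f :: "'n \<Rightarrow> real^'n" where f: "bij_betw f UNIV B"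
    using finB by (metis finite_same_card_bij finite_class.finite_UNIV)
  define P :: "real^'n^'n" where "P = (\<chi> i j. f j $ i)"
  have col: "column j P = f j" for j
    by (simp add: P_def column_def vec_eq_iff)
  have "columns P = B"
    using f by (auto simp: columns_def col bij_betw_def)
  then have "\<exists>Q. P ** Q = mat 1"
    using B(3) by (simp add: matrix_right_invertible_span_columns span_vec_eq)
  then obtain Q where Q: "P ** Q = mat 1" ..
  then have QP: "Q ** P = mat 1" using matrix_left_right_inverse by blast
  have column: "column j (Q ** M ** P) = \<mu> *\<^sub>R axis j 1" if "M *v f j = \<mu> *\<^sub>R f j" for j
  proof -
    have "column j (Q ** M ** P) = Q *v (M *v column j P)"
      by (simp add: matrix_vector_mul_assoc matrix_mul_assoc flip: matrix_vector_mult_basis)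
    also have "\<dots> = \<mu> *\<^sub>R (Q *v column j P)"
      by (simp add: col that matrix_vector_mult_scaleR)
    also have "Q *v column j P = axis j 1"
      by (simp add: matrix_vector_mul_assoc QP flip: matrix_vector_mult_basis)
    finally show ?thesis .
  qed
  obtain a b where "f a = u" "f b = v"
    using f B(1) by (metis bij_betw_imp_surj_on image_iff insert_subset)
  with assms column have "[:- \<mu>, 1:] ^ 2 dvd charpoly (Q ** M ** P)"
    by (intro charpoly_two_scaled_columns[of a b]) auto
  then show ?thesis by (simp add: charpoly_similar QP)
qed

section \<open>Positions in the eigenvalue list and the bound by \<open>rho_perp\<close>\<close>

lemma mset_eigenvalue_list: "mset (eigenvalue_list M) = proots (charpoly M)"
  by (simp add: eigenvalue_list_def)

lemma length_eigenvalue_list_le: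
  fixes M :: "real^'n^'n"
  shows "length (eigenvalue_list M) \<le> CARD('n)"
  using size_proots_le[of "charpoly M"] degree_charpoly_le[of M]
  by (simp flip: mset_eigenvalue_list)

lemma rho_perp_nonneg: "0 \<le> rho_perp M"
  by (simp add: rho_perp_def)

text \<open>Counting from 0, only the first position is left out of the maximum; the length bound
  puts all others into its index range.\<close>

lemma eigenvalue_list_nth_le_rho_perp:
  fixes M :: "real^'n^'n"
  assumes "k < length (eigenvalue_list M)" "k \<noteq> 0"
  shows "\<bar>eigenvalue_list M ! k\<bar> \<le> rho_perp M"
proof -
  have "\<bar>eigenvalue_list M ! k\<bar> = \<bar>nth_eigenvalue M (Suc k)\<bar>"
    by (simp add: nth_eigenvalue_def)
  moreover have "Suc k \<in> {2..CARD('n)}"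
    using assms length_eigenvalue_list_le[of M] by auto
  ultimately show ?thesis
    unfolding rho_perp_def by (intro Max_ge) auto
qed

text \<open>Distinct eigenvalues cannot share a position. For equal ones, orthogonality gives
  independence, hence a double root and two occurrences in the list.\<close>

lemma eigenvalue_list_two_positions:
  fixes M :: "real^'n^'n"
  assumes "u \<noteq> 0" "v \<noteq> 0" "u \<bullet> v = 0" "M *v u = \<kappa> *\<^sub>R u" "M *v v = \<mu> *\<^sub>R v"
  obtains i j where "i \<noteq> j" "i < length (eigenvalue_list M)" "j < length (eigenvalue_list M)"
    "eigenvalue_list M ! i = \<kappa>" "eigenvalue_list M ! j = \<mu>"
proof (cases "\<kappa> = \<mu>")
  case False
  have "set (eigenvalue_list M) = {x. poly (charpoly M) x = 0}"
    by (metis mset_eigenvalue_list set_mset_mset set_count_proots charpoly_nonzero)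
  then have "\<kappa> \<in> set (eigenvalue_list M)" "\<mu> \<in> set (eigenvalue_list M)"
    using assms by (auto simp: poly_charpoly_eq_0_iff)
  with False that show ?thesis by (metis in_set_conv_nth)
next
  case True
  have "u \<noteq> v" using assms by auto
  moreover have "independent {u, v}"
    using assms \<open>u \<noteq> v\<close> by (intro pairwise_orthogonal_independent)
      (auto simp: pairwise_def orthogonal_def inner_commute)
  ultimately have "[:- \<mu>, 1:] ^ 2 dvd charpoly M"
    using assms True by (intro charpoly_double_root[of u v]) auto
  then have "2 \<le> order \<mu> (charpoly M)"
    by (simp add: order_divides charpoly_nonzero)
  then have "2 \<le> length (filter ((=) \<mu>) (eigenvalue_list M))"
    by (simp add: mset_eigenvalue_list charpoly_nonzero flip: count_mset count_list_eq_length_filter)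
  then have "2 \<le> card {i. i < length (eigenvalue_list M) \<and> \<mu> = eigenvalue_list M ! i}"
    by (simp add: length_filter_conv_card)
  then obtain I where "I \<subseteq> {i. i < length (eigenvalue_list M) \<and> \<mu> = eigenvalue_list M ! i}" "card I = 2"
    by (metis obtain_subset_with_card_n)
  then obtain i j where "i \<noteq> j"
    "{i, j} \<subseteq> {i. i < length (eigenvalue_list M) \<and> \<mu> = eigenvalue_list M ! i}"
    by (metis card_2_iff)
  with True that show ?thesis by auto
qed

text \<open>One of the two positions is not 0. If it holds \<open>\<mu>\<close>, the bound is
  direct; if it holds \<open>\<kappa>\<close>, the assumption
  \<open>\<bar>\<mu>\<bar> \<le> \<bar>\<kappa>\<bar>\<close> transfers it.\<close>

lemma orthogonal_eigenvalue_le_rho_perp: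
  fixes M :: "real^'n^'n"
  assumes "u \<noteq> 0" "v \<noteq> 0" "u \<bullet> v = 0" "M *v u = \<kappa> *\<^sub>R u" "M *v v = \<mu> *\<^sub>R v" "\<bar>\<mu>\<bar> \<le> \<bar>\<kappa>\<bar>"
  shows "\<bar>\<mu>\<bar> \<le> rho_perp M"
  using eigenvalue_list_two_positions[OF assms(1-5)] eigenvalue_list_nth_le_rho_perp assms(6)
  by (metis order_trans)

text \<open>By symmetry the hyperplane orthogonal to \<open>u\<close> is invariant, so the norm of
  \<open>M\<close> on it is the modulus of an eigenvalue with eigenvector orthogonal to
  \<open>u\<close>.\<close>

lemma norm_matrix_le_rho_perp:
  fixes M :: "real^'n^'n"
  assumes sym: "transpose M = M" and u: "u \<noteq> 0" "M *v u = \<kappa> *\<^sub>R u"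
    and dominant: "\<And>v \<mu>. v \<noteq> 0 \<Longrightarrow> M *v v = \<mu> *\<^sub>R v \<Longrightarrow> \<bar>\<mu>\<bar> \<le> \<bar>\<kappa>\<bar>"
    and x: "u \<bullet> x = 0"
  shows "norm (M *v x) \<le> rho_perp M * norm x"
proof (cases "x = 0")
  case False
  let ?V = "{y. u \<bullet> y = 0}"
  have "subspace ?V" by (rule subspace_hyperplane)
  moreover have "M *v y \<in> ?V" if "y \<in> ?V" for y
    using that u by (simp flip: symmetric_matrix_inner[OF sym])
  moreover have "\<not> ?V \<subseteq> {0}" using x False by auto
  ultimately obtain v \<mu> where v: "v \<in> ?V" "v \<noteq> 0" "M *v v = \<mu> *\<^sub>R v"
    and "\<And>x. x \<in> ?V \<Longrightarrow> norm (M *v x) \<le> \<bar>\<mu>\<bar> * norm x"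
    using symmetric_matrix_norm_attained[OF sym] by metis
  then have "norm (M *v x) \<le> \<bar>\<mu>\<bar> * norm x" using x by simp
  also have "\<bar>\<mu>\<bar> \<le> rho_perp M"
    using v u dominant by (intro orthogonal_eigenvalue_le_rho_perp[of u v]) auto
  finally show ?thesis by (simp add: mult_right_mono)
qed simp

lemma norm_matrix_power_le_rho_perp:
  fixes M :: "real^'n^'n"
  assumes sym: "transpose M = M" and u: "u \<noteq> 0" "M *v u = \<kappa> *\<^sub>R u"
    and dominant: "\<And>v \<mu>. v \<noteq> 0 \<Longrightarrow> M *v v = \<mu> *\<^sub>R v \<Longrightarrow> \<bar>\<mu>\<bar> \<le> \<bar>\<kappa>\<bar>"
    and x: "u \<bullet> x = 0"
  shows "norm (matrix_power M l *v x) \<le> rho_perp M ^ l * norm x"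
proof -
  \<comment> \<open>Orthogonality to \<open>u\<close> is carried through the induction because the
    one-step bound is available only there.\<close>
  have "u \<bullet> (matrix_power M l *v x) = 0 \<and> norm (matrix_power M l *v x) \<le> rho_perp M ^ l * norm x"
  proof (induction l)
    case (Suc l)
    let ?y = "matrix_power M l *v x"
    have "norm (M *v ?y) \<le> rho_perp M * norm ?y"
      using Suc by (intro norm_matrix_le_rho_perp[OF sym u dominant]) auto
    also have "\<dots> \<le> rho_perp M * (rho_perp M ^ l * norm x)"
      using Suc by (intro mult_left_mono rho_perp_nonneg) auto
    finally show ?case
      using Suc u by (simp add: matrix_vector_mul_assoc[symmetric] mult.assoc flip: symmetric_matrix_inner[OF sym])
  qed (simp add: x)
  then show ?thesis ..
qed

subsection \<open>The normalised adjacency matrix\<close>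

lemma norm_adjacency_nth:
  fixes A :: "real^'n^'n"
  shows "norm_adjacency A $ i $ j = loop_adjacency A $ i $ j / (degree_stat A i * degree_stat A j)"
proof -
  have "(diag v ** M ** diag v) $ i $ j = v $ i * M $ i $ j * v $ j" for v and M :: "real^'n^'n"
    by (simp add: diag_def matrix_matrix_mult_def if_distrib if_distribR cong: if_cong)
  then show ?thesis
    by (simp add: norm_adjacency_def degree_stat_def)
qed

context
  fixes A :: "real^'n^'n"
  assumes A: "adjacency_matrix A"
begin

lemma loop_adjacency_nonneg: "0 \<le> loop_adjacency A $ i $ j"
proof -
  have "A $ i $ j \<in> {0, 1}" using A by (simp add: adjacency_matrix_def)
  then show ?thesis by (auto simp: loop_adjacency_def mat_def)
qed

lemma loop_adjacency_sym: "loop_adjacency A $ i $ j = loop_adjacency A $ j $ i"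
proof -
  have "transpose A $ i $ j = A $ i $ j" using A by (simp add: adjacency_matrix_def)
  then show ?thesis by (simp add: loop_adjacency_def mat_def transpose_def)
qed

lemma loop_degree_eq_sum: "loop_degree A $ i = (\<Sum>j\<in>UNIV. loop_adjacency A $ i $ j)"
  by (simp add: loop_degree_def matrix_vector_mult_def)

text \<open>The added self-loop alone contributes 1, so the normalisation never divides by
  zero.\<close>

lemma loop_degree_ge_1: "1 \<le> loop_degree A $ i"
proof -
  have "A $ i $ i \<in> {0, 1}" using A by (simp add: adjacency_matrix_def)
  then have "1 \<le> loop_adjacency A $ i $ i" by (auto simp: loop_adjacency_def mat_def)
  also have "\<dots> \<le> loop_degree A $ i"
    unfolding loop_degree_eq_sum by (rule member_le_sum) (auto simp: loop_adjacency_nonneg)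
  finally show ?thesis .
qed

lemma degree_stat_ge_1: "1 \<le> degree_stat A i"
  using loop_degree_ge_1[of i] by (simp add: degree_stat_def)

lemma degree_stat_power2: "(degree_stat A i)\<^sup>2 = loop_degree A $ i"
  using loop_degree_ge_1[of i] by (simp add: degree_stat_def)

lemma transpose_norm_adjacency: "transpose (norm_adjacency A) = norm_adjacency A"
  by (simp add: vec_eq_iff transpose_def norm_adjacency_nth loop_adjacency_sym mult.commute)

text \<open>One factor \<open>degree_stat A j\<close> cancels in each entry; the remaining row sum
  is the square of \<open>degree_stat A i\<close>.\<close>

lemma norm_adjacency_degree_stat:
  "norm_adjacency A *v (\<chi> i. degree_stat A i) = (\<chi> i. degree_stat A i)"
proof -
  have "(norm_adjacency A *v (\<chi> i. degree_stat A i)) $ i = degree_stat A i" for i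
  proof -
    have nz: "degree_stat A j \<noteq> 0" for j using degree_stat_ge_1[of j] by linarith
    have "(norm_adjacency A *v (\<chi> i. degree_stat A i)) $ i
        = (\<Sum>j\<in>UNIV. loop_adjacency A $ i $ j / degree_stat A i)"
      by (simp add: matrix_vector_mult_def norm_adjacency_nth nz)
    also have "\<dots> = (degree_stat A i)\<^sup>2 / degree_stat A i"
      by (simp add: degree_stat_power2 loop_degree_eq_sum sum_divide_distrib)
    finally show ?thesis by (simp add: power2_eq_square)
  qed
  then show ?thesis by (simp add: vec_eq_iff)
qed

text \<open>Substituting \<open>y\<^sub>i = v\<^sub>i / d\<^sub>i\<close>, this is
  \<open>2 \<bar>y\<^sub>i y\<^sub>j\<bar> \<le> y\<^sub>i\<^sup>2 + y\<^sub>j\<^sup>2\<close> summed with the entries of \<open>loop_adjacency A\<close> as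
  weights.\<close>

lemma norm_adjacency_quadratic_form_le:
  "\<bar>v \<bullet> (norm_adjacency A *v v)\<bar> \<le> v \<bullet> v"
proof -
  let ?a = "\<lambda>i j. loop_adjacency A $ i $ j"
  define y where "y i = v $ i / degree_stat A i" for i
  have nz: "degree_stat A j \<noteq> 0" for j using degree_stat_ge_1[of j] by linarith
  have half: "(\<Sum>i\<in>UNIV. \<Sum>j\<in>UNIV. ?a i j * (y i)\<^sup>2) = v \<bullet> v"
  proof -
    have "(\<Sum>j\<in>UNIV. ?a i j * (y i)\<^sup>2) = v $ i * v $ i" for i
    proof -
      have "(\<Sum>j\<in>UNIV. ?a i j * (y i)\<^sup>2) = (degree_stat A i)\<^sup>2 * (y i)\<^sup>2"
        by (simp only: degree_stat_power2 loop_degree_eq_sum sum_distrib_right)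
      then show ?thesis
        using nz[of i] by (simp add: y_def power_divide power2_eq_square)
    qed
    then show ?thesis by (simp add: inner_vec_def)
  qed
  have half': "(\<Sum>i\<in>UNIV. \<Sum>j\<in>UNIV. ?a i j * (y j)\<^sup>2) = v \<bullet> v"
    unfolding half[symmetric] by (subst sum.swap) (intro sum.cong refl, simp add: loop_adjacency_sym)
  have "v \<bullet> (norm_adjacency A *v v) = (\<Sum>i\<in>UNIV. \<Sum>j\<in>UNIV. ?a i j * (y i * y j))"
    by (simp add: inner_vec_def matrix_vector_mult_def norm_adjacency_nth y_def sum_distrib_left mult_ac)
  also have "\<bar>\<dots>\<bar> \<le> (\<Sum>i\<in>UNIV. \<Sum>j\<in>UNIV. \<bar>?a i j * (y i * y j)\<bar>)"
    by (intro order_trans[OF sum_abs] sum_mono sum_abs)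
  also have "\<dots> \<le> (\<Sum>i\<in>UNIV. \<Sum>j\<in>UNIV. ?a i j * (((y i)\<^sup>2 + (y j)\<^sup>2) / 2))"
  proof (intro sum_mono)
    fix i j
    have "\<bar>y i * y j\<bar> \<le> ((y i)\<^sup>2 + (y j)\<^sup>2) / 2"
      using sum_squares_bound[of "\<bar>y i\<bar>" "\<bar>y j\<bar>"] by (simp add: abs_mult)
    then have "?a i j * \<bar>y i * y j\<bar> \<le> ?a i j * (((y i)\<^sup>2 + (y j)\<^sup>2) / 2)"
      by (intro mult_left_mono loop_adjacency_nonneg)
    then show "\<bar>?a i j * (y i * y j)\<bar> \<le> ?a i j * (((y i)\<^sup>2 + (y j)\<^sup>2) / 2)"
      by (simp only: abs_mult[of "?a i j"] abs_of_nonneg[OF loop_adjacency_nonneg])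
  qed
  also have "\<dots> = ((\<Sum>i\<in>UNIV. \<Sum>j\<in>UNIV. ?a i j * (y i)\<^sup>2) + (\<Sum>i\<in>UNIV. \<Sum>j\<in>UNIV. ?a i j * (y j)\<^sup>2)) / 2"
    by (simp add: sum.distrib distrib_left add_divide_distrib flip: sum_divide_distrib)
  finally show ?thesis by (simp add: half half')
qed

lemma norm_adjacency_eigenvalue_le_1:
  assumes "v \<noteq> 0" "norm_adjacency A *v v = \<mu> *\<^sub>R v"
  shows "\<bar>\<mu>\<bar> \<le> 1"
proof -
  have "\<bar>\<mu>\<bar> * (v \<bullet> v) \<le> 1 * (v \<bullet> v)"
    using norm_adjacency_quadratic_form_le[of v] assms(2) by (simp add: abs_mult)
  then show ?thesis using assms(1) by (simp add: mult_le_cancel_right)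
qed

text \<open>Every power fixes \<open>u\<close>, so the projection coefficient
  \<open>\<alpha>\<close> of \<open>x\<close> onto \<open>u\<close> serves all \<open>l\<close> and
  \<open>i\<close> at once; only the orthogonal remainder is multiplied by the power.\<close>

lemma matrix_power_norm_adjacency_decomp:
  obtains \<alpha> where "\<bar>\<alpha>\<bar> \<le> norm x"
    "\<And>l i. \<bar>(matrix_power (norm_adjacency A) l *v x) $ i - \<alpha> * degree_stat A i\<bar>
        \<le> rho_perp (norm_adjacency A) ^ l * norm x"
proof -
  define u :: "real^'n" where "u = (\<chi> i. degree_stat A i)"
  define \<alpha> where "\<alpha> = (u \<bullet> x) / (u \<bullet> u)"
  define y where "y = x - \<alpha> *\<^sub>R u"
  \<comment> \<open>\<open>undefined\<close> stands for an arbitrary node.\<close>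
  have u1: "1 \<le> norm u"
    using degree_stat_ge_1[of undefined] component_le_norm_cart[of u undefined] by (simp add: u_def)
  then have u0: "u \<noteq> 0" by auto
  have Mu: "norm_adjacency A *v u = u"
    unfolding u_def by (rule norm_adjacency_degree_stat)
  have pow_u: "matrix_power (norm_adjacency A) l *v u = u" for l
    by (induction l) (simp_all add: Mu flip: matrix_vector_mul_assoc)
  have uy: "u \<bullet> y = 0" using u0 by (simp add: y_def \<alpha>_def inner_diff_right)
  have x: "x = \<alpha> *\<^sub>R u + y" by (simp add: y_def)
  have "(norm x)\<^sup>2 = (norm (\<alpha> *\<^sub>R u))\<^sup>2 + (norm y)\<^sup>2"
    using uy by (subst x, intro norm_add_Pythagorean) (simp add: orthogonal_def)
  then have "(norm (\<alpha> *\<^sub>R u))\<^sup>2 \<le> (norm x)\<^sup>2" "(norm y)\<^sup>2 \<le> (norm x)\<^sup>2"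
    by simp_all
  then have *: "norm (\<alpha> *\<^sub>R u) \<le> norm x" "norm y \<le> norm x"
    using norm_ge_zero power2_le_imp_le by blast+
  have "\<bar>\<alpha>\<bar> * 1 \<le> \<bar>\<alpha>\<bar> * norm u" using u1 by (intro mult_left_mono) auto
  with * have 1: "\<bar>\<alpha>\<bar> \<le> norm x" by simp
  have 2: "\<bar>(matrix_power (norm_adjacency A) l *v x) $ i - \<alpha> * degree_stat A i\<bar>
        \<le> rho_perp (norm_adjacency A) ^ l * norm x" for l i
  proof -
    let ?P = "matrix_power (norm_adjacency A) l"
    have "?P *v x = \<alpha> *\<^sub>R u + ?P *v y"
      by (subst x) (simp add: matrix_vector_right_distrib matrix_vector_mult_scaleR pow_u)
    then have "(?P *v x) $ i - \<alpha> * degree_stat A i = (?P *v y) $ i"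
      by (simp add: u_def)
    also have "\<bar>\<dots>\<bar> \<le> norm (?P *v y)" by (rule component_le_norm_cart)
    also have "\<dots> \<le> rho_perp (norm_adjacency A) ^ l * norm y"
      using Mu uy norm_adjacency_eigenvalue_le_1
      by (intro norm_matrix_power_le_rho_perp[OF transpose_norm_adjacency u0, of 1]) auto
    also have "\<dots> \<le> rho_perp (norm_adjacency A) ^ l * norm x"
      by (intro mult_left_mono * zero_le_power rho_perp_nonneg)
    finally show ?thesis .
  qed
  show ?thesis using that 1 2 by blast
qed

text \<open>In each coordinate the common multiple of the degree statistic gives the first term, and
  the errors at the two nodes give the factor 2. Summing over coordinates dominates the Euclidean
  norm by the l1 norm.\<close>

lemma dist_sgc_le:
  fixes X :: "real^'f^'n"
  defines "K \<equiv> (\<Sum>k\<in>UNIV. norm (column k X))"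
  shows "dist (sgc l X A i) (sgc l X A j)
    \<le> K * dist (degree_stat A i) (degree_stat A j) + 2 * K * rho_perp (norm_adjacency A) ^ l"
proof -
  let ?r = "rho_perp (norm_adjacency A) ^ l" and ?d = "dist (degree_stat A i) (degree_stat A j)"
  have sgc: "sgc l X A i $ k = (matrix_power (norm_adjacency A) l *v column k X) $ i" for i k
    by (simp add: sgc_def row_def column_def matrix_matrix_mult_def matrix_vector_mult_def)
  have "\<bar>(sgc l X A i - sgc l X A j) $ k\<bar> \<le> norm (column k X) * (?d + 2 * ?r)" for k
  proof -
    obtain \<alpha> where \<alpha>: "\<bar>\<alpha>\<bar> \<le> norm (column k X)"
      and err: "\<And>i. \<bar>sgc l X A i $ k - \<alpha> * degree_stat A i\<bar> \<le> ?r * norm (column k X)"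
      using matrix_power_norm_adjacency_decomp[of "column k X"] unfolding sgc by metis
    have "\<bar>\<alpha> * degree_stat A i - \<alpha> * degree_stat A j\<bar> \<le> norm (column k X) * ?d"
      using mult_right_mono[OF \<alpha>, of ?d] by (simp add: dist_real_def flip: right_diff_distrib abs_mult)
    with err[of i] err[of j] show ?thesis
      by (simp add: algebra_simps)
  qed
  then have "(\<Sum>k\<in>UNIV. \<bar>(sgc l X A i - sgc l X A j) $ k\<bar>) \<le> (\<Sum>k\<in>UNIV. norm (column k X) * (?d + 2 * ?r))"
    by (rule sum_mono)
  also have "\<dots> = K * (?d + 2 * ?r)"
    by (simp only: K_def sum_distrib_right)
  also have "\<dots> = K * ?d + 2 * K * ?r"
    by (simp add: algebra_simps)
  finally show ?thesis
    using norm_le_l1_cart[of "sgc l X A i - sgc l X A j"] by (simp add: dist_norm)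
qed

end

theorem proposition6p1:
  shows "\<exists>(C1 :: real^'f^'n \<Rightarrow> real^'n^'n \<Rightarrow> real) (C2 :: real^'f^'n \<Rightarrow> real^'n^'n \<Rightarrow> real).
    \<forall>(A :: real^'n^'n) (X :: real^'f^'n). adjacency_matrix A \<longrightarrow>
      (\<forall>(S :: 'n set) (T :: 'n set) (l :: nat). S \<noteq> {} \<longrightarrow> T \<noteq> {} \<longrightarrow>
        wasserstein (push_uniform (sgc l X A) S) (push_uniform (sgc l X A) T)
        \<le> ennreal (C1 X (norm_adjacency A)) *
            wasserstein (push_uniform (degree_stat A) S) (push_uniform (degree_stat A) T)
          + ennreal (C2 X (norm_adjacency A) * rho_perp (norm_adjacency A) ^ l))"
  unfolding push_uniform_def
  \<comment> \<open>The witnesses are the constants of \<open>dist_sgc_le\<close>, built from the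
    column norms of \<open>X\<close>, and they serve every graph at once.\<close>
  by (intro exI[of _ "\<lambda>X _. \<Sum>k\<in>UNIV. norm (column k X)"]
      exI[of _ "\<lambda>X _. 2 * (\<Sum>k\<in>UNIV. norm (column k X))"] allI impI
      wasserstein_distr_le dist_sgc_le mult_nonneg_nonneg zero_le_power rho_perp_nonneg sum_nonneg)
    auto

end
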